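(* Let $R=Q/P$ be a nonconstant rational function with $P,Q\in\mathbb{C}[z]$ coprime. Suppose that $z_0\in\mathbb{C}$ is a pole of $R$ of order $s\ge1$, and write $$R(z)=\frac{a}{(z-z_0)^s}+O\bigl((z-z_0)^{-s+1}\bigr),\qquad a\neq0.$$ Then near $z_0$ the inflection curve $\mathfrak{I}_R$ has $s+1$ smooth real analytic branches through $z_0$, with tangent rays determined by $$\arg(z-z_0)=\frac{\arg(-sa)+m\pi}{s+1},\qquad m=0,1,\ldots,2s+1.$$ Opposite rays in this list belong to the same analytic branch. In particular, if $z_0$ is a simple pole of $R$, then $z_0$ is an ordinary real node of $\mathfrak{I}_R$.
   Context: The affine inflection curve $\mathfrak{I}_R$ is the closure in $\mathbb{C}$ of $\{z\in\mathbb{C}: R(z)\neq0,\ P(z)\neq0,\ \operatorname{Im}R'(z)=0\}$; equivalently it is the zero set in $\mathbb{C}$ of $F_R=\frac{1}{2i}\bigl(W\overline{P}^{\,2}-\overline{W}P^2\bigr)$ with $W=Q'P-QP'$. An ordinary real node is a point at which the curve locally consists of exactly two smooth real branches crossing transversally. *)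

theory Defs
  imports "HOL-Complex_Analysis.Complex_Analysis" "HOL-Library.Landau_Symbols"
begin

definition rat_fun :: "complex poly \<Rightarrow> complex poly \<Rightarrow> complex \<Rightarrow> complex" where
  "rat_fun Q P z = poly Q z / poly P z"

definition inflection_curve :: "complex poly \<Rightarrow> complex poly \<Rightarrow> complex set" where
  "inflection_curve Q P =
     closure {z. rat_fun Q P z \<noteq> 0 \<and> poly P z \<noteq> 0 \<and> Im (deriv (rat_fun Q P) z) = 0}"

definition real_analytic_on :: "(real \<Rightarrow> 'a::real_normed_vector) \<Rightarrow> real set \<Rightarrow> bool" where
  "real_analytic_on f S \<longleftrightarrow>
     (\<forall>t0\<in>S. \<exists>c. \<exists>r>0. \<forall>t. \<bar>t - t0\<bar> < r \<longrightarrow> (\<lambda>n. (t - t0) ^ n *\<^sub>R c n) sums f t)"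

(* A smooth real analytic branch through p, as a subset of the neighbourhood U of p:
   a regularly parametrized, embedded analytic arc with p as an interior point.
   Closedness in U says that the arc does not end inside U. *)
definition analytic_branch :: "complex set \<Rightarrow> complex \<Rightarrow> complex set \<Rightarrow> bool" where
  "analytic_branch U p B \<longleftrightarrow>
     closedin (top_of_set U) B \<and>
     (\<exists>\<gamma> g. real_analytic_on \<gamma> {-1<..<1} \<and> \<gamma> 0 = p \<and>
        (\<forall>t\<in>{-1<..<1}. vector_derivative \<gamma> (at t) \<noteq> 0) \<and>
        homeomorphism {-1<..<1} B \<gamma> g)"

definition local_branches :: "complex set \<Rightarrow> complex \<Rightarrow> complex set set \<Rightarrow> bool" where
  "local_branches C p \<B> \<longleftrightarrow>
     finite \<B> \<and>
     (\<exists>U. open U \<and> p \<in> U \<and> C \<inter> U = \<Union>\<B> \<and> (\<forall>B\<in>\<B>. analytic_branch U p B)) \<and>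
     pairwise (\<lambda>A B. A \<inter> B = {p}) \<B>"

(* A ray issuing from p is encoded by its unit direction vector; the tangent rays of B at p
   are the limits of the directions of secants from p to points of B tending to p. *)
definition tangent_directions :: "complex set \<Rightarrow> complex \<Rightarrow> complex set" where
  "tangent_directions B p =
     {u. \<exists>b :: nat \<Rightarrow> complex. (\<forall>n. b n \<in> B - {p}) \<and> b \<longlonglongrightarrow> p \<and> (\<lambda>n. sgn (b n - p)) \<longlonglongrightarrow> u}"

(* Here span is the real span, so the last condition says that the tangent lines
   of the two branches at p together span the plane. *)
definition ordinary_real_node :: "complex set \<Rightarrow> complex \<Rightarrow> bool" where
  "ordinary_real_node C p \<longleftrightarrow>
     (\<exists>A B. A \<noteq> B \<and> local_branches C p {A, B} \<and>
        span (tangent_directions A p \<union> tangent_directions B p) = UNIV)"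

definition ray_angle :: "real \<Rightarrow> nat \<Rightarrow> nat \<Rightarrow> real" where
  "ray_angle \<alpha> s m = (\<alpha> + real m * pi) / (real s + 1)"

end

theory Submission
  imports Defs
begin

text \<open>
  Near the pole, \<open>R'(z) = k(z) / (z - z0)^(s + 1)\<close> with \<open>k\<close> holomorphic and \<open>k(z0) = -s a \<noteq> 0\<close>. A branch of
  \<open>(k(z0) / k)^(1 / (s + 1))\<close> exists near \<open>z0\<close>, so a suitable local biholomorphism \<open>\<psi>\<close> with
  \<open>\<psi>'(z0) = exp (-i \<alpha> / (s + 1))\<close> turns \<open>R'\<close> into \<open>|s a| / \<psi>^(s + 1)\<close>. Hence \<open>R'\<close> is real
  exactly where \<open>\<psi>^(s + 1)\<close> is, and the inflection curve is the \<open>\<psi>\<close>-preimage of \<open>s + 1\<close> equally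
  spaced lines through the origin; the inverse of \<open>\<psi>\<close> parametrizes the branches.
\<close>

section \<open>Preimages of lines under a local biholomorphism\<close>

text \<open>By de Moivre, for nonzero \<open>w\<close> the power is real iff \<open>n\<close> times
  an argument of \<open>w\<close> is a multiple of pi. Only \<open>n\<close> lines occur because the
  real factor \<open>t\<close> may be negative: angles that differ by pi give the same line.\<close>

lemma Im_power_eq_0_iff:
  fixes w :: complex
  assumes "n \<ge> 1"
  shows "Im (w ^ n) = 0 \<longleftrightarrow> (\<exists>m<n. \<exists>t::real. w = of_real t * cis (real m * pi / real n))"
proof
  assume im: "Im (w ^ n) = 0"
  define \<theta> where "\<theta> = Arg w"
  have w: "w = of_real (norm w) * cis \<theta>"
    using rcis_cmod_Arg[of w] by (simp add: rcis_def \<theta>_def)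
  have "(of_real (norm w) * cis \<theta>) ^ n = of_real (norm w ^ n) * cis (real n * \<theta>)"
    by (simp only: power_mult_distrib Complex.DeMoivre of_real_power)
  hence "Im (w ^ n) = Im (of_real (norm w ^ n) * cis (real n * \<theta>))"
    by (simp only: w[symmetric])
  hence "norm w ^ n * sin (real n * \<theta>) = 0" using im by (simp del: of_real_power)
  show "\<exists>m<n. \<exists>t::real. w = of_real t * cis (real m * pi / real n)"
  proof (cases "w = 0")
    case True
    thus ?thesis using assms by (intro exI[of _ 0]) auto
  next
    case False
    with \<open>norm w ^ n * sin (real n * \<theta>) = 0\<close> have "sin (real n * \<theta>) = 0" by simp
    then obtain i :: int where i: "real n * \<theta> = of_int i * pi"
      by (auto simp: sin_zero_iff_int2)
    \<comment> \<open>The quotient by \<open>n\<close> adds a multiple of pi to the angle, hence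
      only a sign, which \<open>t\<close> absorbs; the remainder selects the line.\<close>
    define m where "m = nat (i mod int n)"
    define q where "q = i div int n"
    have m: "m < n" and "i = q * int n + int m"
      using assms by (auto simp: m_def q_def nat_less_iff)
    hence "real_of_int i = of_int q * real n + real m" by simp
    hence "\<theta> = pi * of_int q + real m * pi / real n"
      using i assms by (simp add: field_simps)
    hence "cis \<theta> = cis (pi * of_int q) * cis (real m * pi / real n)"
      by (simp add: cis_mult)
    also have "cis (pi * of_int q) = of_real (cos (pi * of_int q))"
      by (auto simp: complex_eq_iff sin_zero_iff_int2)
    finally have "w = of_real (norm w * cos (pi * of_int q)) * cis (real m * pi / real n)"
      using w by (simp add: mult.assoc)
    thus ?thesis using m by blast
  qed
next
  assume "\<exists>m<n. \<exists>t::real. w = of_real t * cis (real m * pi / real n)"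
  then obtain m and t :: real where "w = of_real t * cis (real m * pi / real n)" by blast
  hence "w ^ n = of_real (t ^ n) * cis (real n * (real m * pi / real n))"
    by (simp only: power_mult_distrib Complex.DeMoivre of_real_power)
  thus "Im (w ^ n) = 0" using assms by simp
qed

text \<open>The chart maps \<open>U\<close> onto a full disc around 0. Hence each line through 0
  meets the image in one open segment, whose preimage is an arc that does not end inside
  \<open>U\<close>.\<close>

locale straightening_chart =
  fixes U :: "complex set" and p :: complex and \<rho> :: real and \<psi> \<phi> :: "complex \<Rightarrow> complex"
  assumes open_U: "open U" and radius_pos: "\<rho> > 0"
    and holomorphic_chart: "\<psi> holomorphic_on U"
    and holomorphic_inverse: "\<phi> holomorphic_on ball 0 \<rho>"
    and chart_in_ball: "z \<in> U \<Longrightarrow> \<psi> z \<in> ball 0 \<rho>"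
    and inverse_in_U: "w \<in> ball 0 \<rho> \<Longrightarrow> \<phi> w \<in> U"
    and inverse_chart: "z \<in> U \<Longrightarrow> \<phi> (\<psi> z) = z"
    and chart_inverse: "w \<in> ball 0 \<rho> \<Longrightarrow> \<psi> (\<phi> w) = w"
    and inverse_0: "\<phi> 0 = p"
begin

definition line_preimage :: "complex \<Rightarrow> complex set" where
  "line_preimage e = {z \<in> U. \<exists>t::real. \<psi> z = of_real t * e}"

text \<open>For unit \<open>e\<close>, the factor \<open>\<rho>\<close> rescales the segment to the
  parameter interval \<open>{-1<..<1}\<close> that \<open>analytic_branch\<close>
  prescribes.\<close>

definition line_param :: "complex \<Rightarrow> real \<Rightarrow> complex" where
  "line_param e t = \<phi> (of_real (\<rho> * t) * e)"

lemma center_in_U: "p \<in> U"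
  using inverse_in_U[of 0] radius_pos inverse_0 by simp

lemma chart_center: "\<psi> p = 0"
  using chart_inverse[of 0] radius_pos inverse_0 by simp

lemma chart_eq_0_iff: "z \<in> U \<Longrightarrow> \<psi> z = 0 \<longleftrightarrow> z = p"
  using inverse_chart[of z] inverse_0 chart_center by auto

lemma center_in_line_preimage: "p \<in> line_preimage e"
  unfolding line_preimage_def using center_in_U chart_center by (auto intro: exI[of _ 0])

text \<open>This is the chain rule for \<open>\<psi> (\<phi> w) = w\<close>. It makes the
  parametrized branches regular, and at \<open>w = 0\<close> it determines how their tangents are
  rotated.\<close>

lemma deriv_inverse:
  assumes "w \<in> ball 0 \<rho>"
  shows "deriv \<phi> w * deriv \<psi> (\<phi> w) = 1"
  by (rule deriv_left_inverse[OF holomorphic_inverse holomorphic_chart])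
     (use assms open_U inverse_in_U chart_inverse in auto)

lemma line_arg_in_ball:
  fixes e :: complex
  assumes "norm e = 1" and "t \<in> {-1<..<1}"
  shows "of_real (\<rho> * t) * e \<in> ball 0 \<rho>"
proof -
  have "norm (of_real (\<rho> * t) * e) = \<rho> * \<bar>t\<bar>"
    using assms radius_pos by (simp add: norm_mult)
  also have "\<dots> < \<rho> * 1"
    using assms radius_pos by (intro mult_strict_left_mono) auto
  finally show ?thesis by simp
qed

lemma line_param_0: "line_param e 0 = p"
  by (simp add: line_param_def inverse_0)

lemma chart_line_param:
  assumes "norm e = 1" and "t \<in> {-1<..<1}"
  shows "\<psi> (line_param e t) = of_real (\<rho> * t) * e"
  unfolding line_param_def by (rule chart_inverse[OF line_arg_in_ball[OF assms]])

lemma line_preimageE: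
  assumes "norm e = 1" and "z \<in> line_preimage e"
  obtains t where "t \<in> {-1<..<1}" and "z = line_param e t"
proof -
  from assms(2) obtain t where z: "z \<in> U" and t: "\<psi> z = of_real t * e"
    by (auto simp: line_preimage_def)
  have "\<bar>t\<bar> < \<rho>"
    using chart_in_ball[OF z] t assms(1) by (simp add: norm_mult)
  hence "t / \<rho> \<in> {-1<..<1}"
    using radius_pos by (auto simp: field_simps abs_less_iff)
  moreover have "z = line_param e (t / \<rho>)"
    using radius_pos inverse_chart[OF z] t by (simp add: line_param_def)
  ultimately show ?thesis by (rule that)
qed

lemma line_param_image:
  assumes "norm e = 1"
  shows "line_param e ` {-1<..<1} = line_preimage e"
proof
  show "line_param e ` {-1<..<1} \<subseteq> line_preimage e"
  proof clarify
    fix t :: real assume t: "t \<in> {-1<..<1}"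
    have "line_param e t \<in> U"
      unfolding line_param_def by (rule inverse_in_U[OF line_arg_in_ball[OF assms t]])
    with chart_line_param[OF assms t] show "line_param e t \<in> line_preimage e"
      unfolding line_preimage_def by blast
  qed
  show "line_preimage e \<subseteq> line_param e ` {-1<..<1}"
    using line_preimageE[OF assms] by blast
qed

section \<open>Regular analytic parametrization of a pulled-back line\<close>

lemma has_vector_derivative_line_param:
  assumes "norm e = 1" and "t \<in> {-1<..<1}"
  shows "(line_param e has_vector_derivative
           (of_real \<rho> * e * deriv \<phi> (of_real (\<rho> * t) * e))) (at t)"
proof -
  let ?w = "of_real (\<rho> * t) * e"
  have "(\<phi> has_field_derivative deriv \<phi> ?w) (at ?w)"
    using holomorphic_derivI[OF holomorphic_inverse open_ball line_arg_in_ball[OF assms]] .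
  moreover have "((\<lambda>t. of_real (\<rho> * t) * e) has_vector_derivative (of_real \<rho> * e)) (at t)"
    by (auto intro!: derivative_eq_intros has_vector_derivative_real_field)
  ultimately have "(\<phi> \<circ> (\<lambda>t. of_real (\<rho> * t) * e) has_vector_derivative
      (of_real \<rho> * e * deriv \<phi> ?w)) (at t)"
    using field_vector_diff_chain_at by blast
  thus ?thesis by (simp add: line_param_def[abs_def] o_def)
qed

text \<open>The complex Taylor series of \<open>\<phi>\<close> at a point of the line, restricted to
  that line, is a power series in the real parameter; the powers of
  \<open>of_real \<rho> * e\<close> go into the coefficients.\<close>

lemma real_analytic_line_param:
  assumes "norm e = 1"
  shows "real_analytic_on (line_param e) {-1<..<1}"
  unfolding real_analytic_on_def
proof
  fix t0 :: real assume t0: "t0 \<in> {-1<..<1}"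
  let ?c = "of_real (\<rho> * t0) * e"
  have "?c \<in> ball 0 \<rho>" by (rule line_arg_in_ball[OF assms t0])
  then obtain d where d: "d > 0" "ball ?c d \<subseteq> ball 0 \<rho>"
    by (rule openE[OF open_ball])
  have hol: "\<phi> holomorphic_on ball ?c d"
    by (rule holomorphic_on_subset[OF holomorphic_inverse d(2)])
  define c where "c n = (deriv ^^ n) \<phi> ?c / fact n * (of_real \<rho> * e) ^ n" for n
  show "\<exists>c. \<exists>r>0. \<forall>t. \<bar>t - t0\<bar> < r \<longrightarrow> (\<lambda>n. (t - t0) ^ n *\<^sub>R c n) sums line_param e t"
  proof (intro exI[of _ c] exI[of _ "d / \<rho>"] conjI allI impI)
    show "d / \<rho> > 0" using d radius_pos by simp
    fix t assume "\<bar>t - t0\<bar> < d / \<rho>"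
    hence less: "\<rho> * \<bar>t - t0\<bar> < d" using radius_pos by (simp add: field_simps)
    let ?w = "of_real (\<rho> * t) * e"
    have diff: "?w - ?c = of_real (t - t0) * (of_real \<rho> * e)"
      by (simp only: of_real_mult of_real_diff left_diff_distrib right_diff_distrib mult_ac)
    hence "norm (?w - ?c) = \<rho> * \<bar>t - t0\<bar>"
      using radius_pos assms by (simp only: norm_mult norm_of_real mult.commute) simp
    hence "?w \<in> ball ?c d" using less by (simp add: dist_norm norm_minus_commute)
    from holomorphic_power_series[OF hol this]
    have "(\<lambda>n. (deriv ^^ n) \<phi> ?c / fact n * (?w - ?c) ^ n) sums \<phi> ?w" .
    moreover have "(deriv ^^ n) \<phi> ?c / fact n * (?w - ?c) ^ n = (t - t0) ^ n *\<^sub>R c n" for n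
      unfolding diff c_def power_mult_distrib scaleR_conv_of_real of_real_power by (simp only: mult_ac)
    ultimately show "(\<lambda>n. (t - t0) ^ n *\<^sub>R c n) sums line_param e t"
      by (simp add: line_param_def)
  qed
qed

lemma closedin_line_preimage:
  assumes "norm e = 1"
  shows "closedin (top_of_set U) (line_preimage e)"
proof -
  \<comment> \<open>For a unit vector, multiplying by \<open>cnj e\<close> is dividing by
    \<open>e\<close>. Lying on the line thus becomes the vanishing of a continuous real
    function.\<close>
  have *: "(\<exists>t::real. w = of_real t * e) \<longleftrightarrow> Im (w * cnj e) = 0" for w
  proof -
    have e: "e * cnj e = 1"
      using assms by (simp add: complex_norm_square[symmetric])
    have "w = of_real (Re (w * cnj e)) * e" if "Im (w * cnj e) = 0"
    proof -
      have "of_real (Re (w * cnj e)) = w * cnj e"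
        using that by (simp add: complex_eq_iff)
      thus ?thesis using e by (simp add: mult.assoc mult.commute)
    qed
    moreover have "Im (of_real t * e * cnj e) = 0" for t
      unfolding mult.assoc e by simp
    ultimately show ?thesis by blast
  qed
  have "continuous_on U (\<lambda>z. Im (\<psi> z * cnj e))"
    using holomorphic_on_imp_continuous_on[OF holomorphic_chart] by (intro continuous_intros)
  hence "closedin (top_of_set U) {z \<in> U. Im (\<psi> z * cnj e) = 0}"
    by (rule continuous_closedin_preimage_constant)
  thus ?thesis by (simp only: line_preimage_def *)
qed

lemma analytic_branch_line_preimage:
  assumes "norm e = 1"
  shows "analytic_branch U p (line_preimage e)"
  unfolding analytic_branch_def
\<comment> \<open>On the arc \<open>\<psi> z / e\<close> is already real, so \<open>Re\<close> only
  changes the type, and the division by \<open>\<rho>\<close> undoes the rescaling.\<close>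
proof (intro conjI exI[of _ "line_param e"] exI[of _ "\<lambda>z. Re (\<psi> z / e) / \<rho>"] ballI)
  show "closedin (top_of_set U) (line_preimage e)"
    by (rule closedin_line_preimage[OF assms])
  show "real_analytic_on (line_param e) {-1<..<1}"
    by (rule real_analytic_line_param[OF assms])
  show "line_param e 0 = p" by (rule line_param_0)
  show "vector_derivative (line_param e) (at t) \<noteq> 0" if t: "t \<in> {-1<..<1}" for t
  proof -
    have "deriv \<phi> (of_real (\<rho> * t) * e) \<noteq> 0"
      using deriv_inverse[OF line_arg_in_ball[OF assms t]] by auto
    thus ?thesis
      using vector_derivative_at[OF has_vector_derivative_line_param[OF assms t]]
        radius_pos assms by auto
  qed
  have e: "e \<noteq> 0" using assms by auto
  have left: "Re (\<psi> (line_param e t) / e) / \<rho> = t" if "t \<in> {-1<..<1}" for t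
    unfolding chart_line_param[OF assms that] using radius_pos e by simp
  show "homeomorphism {-1<..<1} (line_preimage e) (line_param e) (\<lambda>z. Re (\<psi> z / e) / \<rho>)"
  proof (rule homeomorphismI)
    show "continuous_on {-1<..<1} (line_param e)"
      by (intro continuous_at_imp_continuous_on ballI
          has_vector_derivative_continuous[OF has_vector_derivative_line_param[OF assms]])
    have "continuous_on (line_preimage e) \<psi>"
      by (rule continuous_on_subset[OF holomorphic_on_imp_continuous_on[OF holomorphic_chart]])
         (auto simp: line_preimage_def)
    thus "continuous_on (line_preimage e) (\<lambda>z. Re (\<psi> z / e) / \<rho>)"
      using e radius_pos by (intro continuous_intros) auto
    show "line_param e ` {-1<..<1} \<subseteq> line_preimage e"
      using line_param_image[OF assms] by simp
    show "(\<lambda>z. Re (\<psi> z / e) / \<rho>) ` line_preimage e \<subseteq> {-1<..<1}"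
      using left by (auto elim!: line_preimageE[OF assms])
    show "\<And>t. t \<in> {-1<..<1} \<Longrightarrow> Re (\<psi> (line_param e t) / e) / \<rho> = t"
      by (rule left)
    show "\<And>z. z \<in> line_preimage e \<Longrightarrow> line_param e (Re (\<psi> z / e) / \<rho>) = z"
      by (metis left line_preimageE[OF assms])
  qed
qed

section \<open>Intersections and tangents of pulled-back lines\<close>

lemma line_preimage_Int:
  assumes "e' \<noteq> 0" and "Im (e / e') \<noteq> 0"
  shows "line_preimage e \<inter> line_preimage e' = {p}"
proof -
  have "z = p" if z: "z \<in> line_preimage e" "z \<in> line_preimage e'" for z
  proof -
    from z(1) obtain t :: real where "z \<in> U" and t: "\<psi> z = of_real t * e"
      by (auto simp: line_preimage_def)
    from z(2) obtain t' :: real where t': "\<psi> z = of_real t' * e'"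
      by (auto simp: line_preimage_def)
    have "of_real t * (e / e') = of_real t'"
      using t t' assms(1) by (simp add: field_simps)
    \<comment> \<open>The quotient of the two directions is not real, so a real multiple of it can
      be real only if the factor \<open>t\<close> is zero.\<close>
    hence "Im (of_real t * (e / e')) = 0" by (simp only: Im_complex_of_real)
    hence "t * Im (e / e') = 0" by (simp only: Im_complex_of_real Re_complex_of_real times_complex.simps mult_zero_left add_0_right)
    hence "t = 0" using assms by simp
    thus ?thesis using \<open>z \<in> U\<close> chart_eq_0_iff t by simp
  qed
  thus ?thesis using center_in_line_preimage by blast
qed

text \<open>This serves the count of branches: if two different lines had the same preimage, it
  would equal their intersection \<open>{p}\<close>.\<close>

lemma line_preimage_not_singleton:
  assumes "norm e = 1"
  shows "line_preimage e \<noteq> {p}"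
proof
  assume *: "line_preimage e = {p}"
  have h: "(1/2::real) \<in> {-1<..<1}" by simp
  have "line_param e (1/2) \<in> line_preimage e"
    using line_param_image[OF assms] h by blast
  hence "\<psi> (line_param e (1/2)) = 0" using * chart_center by simp
  thus False using chart_line_param[OF assms h] radius_pos assms by auto
qed

text \<open>The difference quotient of \<open>line_param e\<close> at 0 tends to a positive multiple
  of \<open>e * deriv \<phi> 0\<close>. A secant direction is the normalized quotient times the sign
  of the parameter, so the two sides of \<open>p\<close> give the two opposite limits.\<close>

lemma tangent_directions_line_preimage:
  assumes "norm e = 1"
  defines "v \<equiv> sgn (e * deriv \<phi> 0)"
  shows "tangent_directions (line_preimage e) p = {v, - v}"
proof -
  define D where "D = of_real \<rho> * e * deriv \<phi> 0"
  have D: "D \<noteq> 0"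
    unfolding D_def using deriv_inverse[of 0] radius_pos assms(1) by auto
  have sgnD: "sgn D = v"
    unfolding D_def v_def using radius_pos by (simp add: sgn_mult mult.assoc sgn_of_real)
  have "(line_param e has_vector_derivative D) (at 0)"
    using has_vector_derivative_line_param[OF assms(1), of 0] by (simp add: D_def)
  hence "((\<lambda>t. (1 / \<bar>t\<bar>) *\<^sub>R (line_param e t - (p + t *\<^sub>R D))) \<longlongrightarrow> 0) (at 0)"
    unfolding has_vector_derivative_def by (simp add: has_derivative_within line_param_0)
  \<comment> \<open>The remainder in the derivative is divided by \<open>\<bar>t\<bar>\<close>, the
    secant by \<open>t\<close>. The results may differ in sign, so only their norms are
    compared.\<close>
  hence "((\<lambda>t. norm ((line_param e t - p) /\<^sub>R t - D)) \<longlongrightarrow> 0) (at 0)"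
  proof (rule tendsto_norm_zero[THEN Lim_transform_eventually], intro eventually_at_filter[THEN iffD2] always_eventually allI impI)
    fix t :: real assume "t \<noteq> 0"
    hence "(line_param e t - p) /\<^sub>R t - D = (1 / t) *\<^sub>R (line_param e t - (p + t *\<^sub>R D))"
      by (simp add: scaleR_diff_right scaleR_add_right divide_inverse)
    thus "norm ((1 / \<bar>t\<bar>) *\<^sub>R (line_param e t - (p + t *\<^sub>R D))) = norm ((line_param e t - p) /\<^sub>R t - D)"
      by simp
  qed
  hence quot: "((\<lambda>t. (line_param e t - p) /\<^sub>R t) \<longlongrightarrow> D) (at 0)"
    by (rule LIM_zero_cancel[OF tendsto_norm_zero_cancel])
  have sgn_quot: "((\<lambda>t. sgn ((line_param e t - p) /\<^sub>R t)) \<longlongrightarrow> v) (at 0)"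
    using tendsto_sgn[OF quot D] unfolding sgnD .
  have lim: "(\<lambda>n. sgn ((line_param e (t n) - p) /\<^sub>R t n)) \<longlonglongrightarrow> v"
    if "t \<longlonglongrightarrow> 0" "\<And>n. t n \<noteq> 0" for t :: "nat \<Rightarrow> real"
    by (rule filterlim_compose[OF sgn_quot]) (use that in \<open>auto simp: filterlim_at\<close>)
  have secant: "sgn (line_param e t - p) = sgn t *\<^sub>R sgn ((line_param e t - p) /\<^sub>R t)"
    if "t \<noteq> 0" for t
    using that by (simp add: sgn_scaleR)
  have "u \<in> {v, - v}" if u: "u \<in> tangent_directions (line_preimage e) p" for u
  proof -
    from u obtain b where b: "\<And>n. b n \<in> line_preimage e" "\<And>n. b n \<noteq> p" "b \<longlonglongrightarrow> p"
      "(\<lambda>n. sgn (b n - p)) \<longlonglongrightarrow> u"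
      by (auto simp: tangent_directions_def)
    have "\<exists>t. t \<in> {-1<..<1} \<and> b n = line_param e t" for n
      by (meson line_preimageE[OF assms(1) b(1)])
    then obtain t where t: "\<And>n. t n \<in> {-1<..<1}" "\<And>n. b n = line_param e (t n)"
      by metis
    have t0: "t n \<noteq> 0" for n using b(2)[of n] t(2)[of n] line_param_0[of e] by auto
    \<comment> \<open>Continuity of the chart turns the convergence of \<open>b\<close> to
      \<open>p\<close> into convergence of the parameters \<open>t n\<close> to 0.\<close>
    have "isCont \<psi> p"
      using holomorphic_on_imp_continuous_on[OF holomorphic_chart] open_U center_in_U
      by (simp add: continuous_on_eq_continuous_at)
    hence "(\<lambda>n. \<psi> (b n)) \<longlonglongrightarrow> \<psi> p" using b(3) by (rule isCont_tendsto_compose)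
    hence "(\<lambda>n. of_real (\<rho> * t n) * e) \<longlonglongrightarrow> 0"
      using chart_line_param[OF assms(1) t(1)] t(2) chart_center by simp
    hence "(\<lambda>n. norm (of_real (\<rho> * t n) * e)) \<longlonglongrightarrow> 0" by (rule tendsto_norm_zero)
    hence "(\<lambda>n. \<rho> * \<bar>t n\<bar> / \<rho>) \<longlonglongrightarrow> 0 / \<rho>"
      using radius_pos assms(1) by (intro tendsto_divide) (auto simp: norm_mult)
    hence "t \<longlonglongrightarrow> 0" using radius_pos by (simp add: tendsto_rabs_zero_iff)
    from lim[OF this t0] have L: "(\<lambda>n. sgn ((b n - p) /\<^sub>R t n)) \<longlonglongrightarrow> v"
      by (simp add: t(2))
    have S: "sgn (b n - p) = sgn (t n) *\<^sub>R sgn ((b n - p) /\<^sub>R t n)" for n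
      using secant[OF t0[of n]] by (simp add: t(2))
    \<comment> \<open>squaring removes the sign of \<open>t n\<close>, so no subsequence of constant sign is needed\<close>
    have "(sgn (b n - p))\<^sup>2 = (sgn ((b n - p) /\<^sub>R t n))\<^sup>2" for n
      using t0[of n] unfolding S[of n] by (cases "t n > 0") (auto simp: scaleR_conv_of_real)
    hence "(\<lambda>n. (sgn (b n - p))\<^sup>2) \<longlonglongrightarrow> v\<^sup>2"
      using tendsto_power[OF L, of 2] by (simp only:)
    hence "u\<^sup>2 = v\<^sup>2"
      using tendsto_power[OF b(4), of 2] by (rule LIMSEQ_unique[rotated])
    thus ?thesis by (simp add: power2_eq_iff)
  qed
  moreover have "\<sigma> *\<^sub>R v \<in> tangent_directions (line_preimage e) p" if \<sigma>: "\<sigma> = 1 \<or> \<sigma> = -1" for \<sigma> :: real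
  proof -
    \<comment> \<open>The double \<open>Suc\<close> keeps all parameters inside the open interval; a
      single one would give the excluded value \<open>\<sigma>\<close> at
      \<open>n = 0\<close>.\<close>
    define t where "t n = \<sigma> * inverse (real (Suc (Suc n)))" for n
    have t: "t n \<in> {-1<..<1}" "t n \<noteq> 0" "sgn (t n) = \<sigma>" for n
      using \<sigma> by (auto simp: t_def field_simps)
    have "t \<longlonglongrightarrow> 0" 
      using tendsto_mult_right_zero[OF LIMSEQ_Suc[OF LIMSEQ_inverse_real_of_nat], of \<sigma>]
      by (simp only: t_def[abs_def])
    have "isCont (line_param e) 0"
      using has_vector_derivative_continuous[OF has_vector_derivative_line_param[OF assms(1), of 0]] by simp
    hence "(\<lambda>n. line_param e (t n)) \<longlonglongrightarrow> line_param e 0"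
      using \<open>t \<longlonglongrightarrow> 0\<close> by (rule isCont_tendsto_compose)
    moreover have "line_param e (t n) \<noteq> p" for n
      using chart_line_param[OF assms(1) t(1)[of n]] chart_center t(2)[of n] radius_pos assms(1) by auto
    moreover have "line_param e (t n) \<in> line_preimage e" for n
      using line_param_image[OF assms(1)] t(1)[of n] by blast
    moreover have "(\<lambda>n. sgn (line_param e (t n) - p)) \<longlonglongrightarrow> \<sigma> *\<^sub>R v"
      using tendsto_scaleR[OF tendsto_const[of \<sigma>] lim[OF \<open>t \<longlonglongrightarrow> 0\<close> t(2)]]
      by (simp add: secant[OF t(2)] t(3))
    ultimately show ?thesis
      unfolding tangent_directions_def using line_param_0[of e] 
      by (auto intro!: exI[of _ "\<lambda>n. line_param e (t n)"])
  qed
  from this[of 1] this[of "-1"] have "v \<in> tangent_directions (line_preimage e) p"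
    "-v \<in> tangent_directions (line_preimage e) p" by simp_all
  ultimately show ?thesis by blast
qed

section \<open>Arrangements of \<open>n\<close> equally spaced lines\<close>

lemma line_preimage_Int_lines:
  assumes "i < n" "j < n" "i \<noteq> j"
  shows "line_preimage (cis (real i * pi / real n)) \<inter> line_preimage (cis (real j * pi / real n)) = {p}"
proof (rule line_preimage_Int)
  \<comment> \<open>Distinct indices below \<open>n\<close> differ by less than \<open>n\<close>, so
    the angle between the lines has absolute value strictly between 0 and pi, where the sine does
    not vanish.\<close>
  have "0 < \<bar>(real i - real j) * pi / real n\<bar>" using assms by simp
  moreover have "\<bar>(real i - real j) * pi / real n\<bar> < pi"
  proof -
    have "\<bar>real i - real j\<bar> < real n" using assms by auto
    hence "\<bar>real i - real j\<bar> * pi < real n * pi" by simp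
    hence "\<bar>real i - real j\<bar> * pi / real n < pi"
      using assms by (simp add: pos_divide_less_eq mult.commute)
    thus ?thesis by (simp add: abs_mult)
  qed
  ultimately have "sin ((real i - real j) * pi / real n) \<noteq> 0"
    using sin_eq_0_pi[of "(real i - real j) * pi / real n"] by (simp only: abs_less_iff) fastforce
  thus "Im (cis (real i * pi / real n) / cis (real j * pi / real n)) \<noteq> 0"
    by (simp add: cis_divide diff_divide_distrib left_diff_distrib)
qed simp

text \<open>The set \<open>S\<close> misses \<open>p\<close>, as the defining set of the inflection
  curve misses a pole. Inside \<open>U\<close> the closure restores exactly this point: the union of
  the preimages is closed in \<open>U\<close>, and \<open>p\<close> is a limit of other points of
  the lines.\<close>

lemma closure_punctured_lines:
  assumes "n \<ge> 1" and S: "S \<inter> U = {z \<in> U - {p}. Im (\<psi> z ^ n) = 0}"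
  shows "closure S \<inter> U = (\<Union>m<n. line_preimage (cis (real m * pi / real n)))" (is "_ = ?T")
proof
  have SU: "S \<inter> U = ?T - {p}"
    unfolding S Im_power_eq_0_iff[OF assms(1)] by (auto simp: line_preimage_def)
  have "closedin (top_of_set U) ?T"
    by (intro closedin_Union) (auto intro!: closedin_line_preimage)
  then obtain K where K: "closed K" "?T = U \<inter> K"
    by (auto simp: closedin_closed)
  \<comment> \<open>Since \<open>U\<close> is open, points of \<open>S\<close> outside
    \<open>U\<close> cannot contribute to the closure inside \<open>U\<close>.\<close>
  have "closure S \<inter> U \<subseteq> closure (S \<inter> U)"
    using open_Int_closure_subset[OF open_U, of S] by (simp add: Int_commute)
  also have "\<dots> \<subseteq> K"
    using SU K by (intro closure_minimal) auto
  finally show "closure S \<inter> U \<subseteq> ?T" using K by auto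
  have "p \<in> closure S"
  proof -
    have B: "line_preimage (cis (real 0 * pi / real n)) \<subseteq> ?T"
      by (rule UN_upper) (use assms(1) in simp)
    \<comment> \<open>A tangent direction comes with a sequence in the punctured line that tends to
      \<open>p\<close>, which is what the closure needs.\<close>
    have "tangent_directions (line_preimage (cis (real 0 * pi / real n))) p \<noteq> {}"
      by (subst tangent_directions_line_preimage) auto
    then obtain b where "\<And>k::nat. b k \<in> line_preimage (cis (real 0 * pi / real n)) - {p}" "b \<longlonglongrightarrow> p"
      by (auto simp: tangent_directions_def)
    moreover from this have "\<And>k. b k \<in> S" using B SU by blast
    ultimately show ?thesis unfolding closure_sequential by blast
  qed
  moreover have "?T \<subseteq> U" by (auto simp: line_preimage_def)
  ultimately show "?T \<subseteq> closure S \<inter> U"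
    using SU closure_subset[of S] by blast
qed

lemma local_branches_lines:
  assumes "C \<inter> U = (\<Union>m<n. line_preimage (cis (real m * pi / real n)))"
  defines "\<B> \<equiv> (\<lambda>m. line_preimage (cis (real m * pi / real n))) ` {..<n}"
  shows "card \<B> = n" and "local_branches C p \<B>"
proof -
  have "inj_on (\<lambda>m. line_preimage (cis (real m * pi / real n))) {..<n}"
  proof (rule inj_onI, rule ccontr)
    fix i j assume "i \<in> {..<n}" "j \<in> {..<n}" "i \<noteq> j"
      and eq: "line_preimage (cis (real i * pi / real n)) = line_preimage (cis (real j * pi / real n))"
    hence "line_preimage (cis (real i * pi / real n)) = {p}"
      using line_preimage_Int_lines[of i n j] by simp
    thus False using line_preimage_not_singleton[of "cis (real i * pi / real n)"] by simp
  qed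
  thus "card \<B> = n" unfolding \<B>_def by (simp add: card_image)
  show "local_branches C p \<B>"
    unfolding local_branches_def
  proof (intro conjI exI[of _ U])
    show "\<forall>B\<in>\<B>. analytic_branch U p B"
      unfolding \<B>_def using analytic_branch_line_preimage by auto
    show "pairwise (\<lambda>A B. A \<inter> B = {p}) \<B>"
    proof (rule pairwiseI)
      fix A B assume "A \<in> \<B>" "B \<in> \<B>" and AB: "A \<noteq> B"
      then obtain i j where "i < n" "A = line_preimage (cis (real i * pi / real n))"
        and "j < n" "B = line_preimage (cis (real j * pi / real n))"
        by (fastforce simp: \<B>_def)
      with AB show "A \<inter> B = {p}" using line_preimage_Int_lines by metis
    qed
    show "finite \<B>" by (simp add: \<B>_def)
    show "C \<inter> U = \<Union>\<B>" unfolding \<B>_def by (rule assms(1))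
  qed (rule open_U center_in_U)+
qed

end

text \<open>A holomorphic map with nonzero derivative at \<open>p\<close> is injective near
  \<open>p\<close> and has an open image there. Cutting the domain down to the preimage of a disc in
  that image makes the new image exactly a disc.\<close>

lemma straightening_chart_exists:
  assumes "d > 0" and hol: "\<psi> holomorphic_on ball p d" and "\<psi> p = 0" and "deriv \<psi> p \<noteq> 0"
  obtains U \<rho> \<phi> where "U \<subseteq> ball p d" and "straightening_chart U p \<rho> \<psi> \<phi>"
proof -
  obtain r where r: "r > 0" "ball p r \<subseteq> ball p d" "inj_on \<psi> (ball p r)"
    using has_complex_derivative_locally_injective[OF hol _ _ assms(4)] assms(1) by auto
  have hol': "\<psi> holomorphic_on ball p r" by (rule holomorphic_on_subset[OF hol r(2)])
  obtain \<phi> where \<phi>: "\<phi> holomorphic_on \<psi> ` ball p r"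
    "\<And>z. z \<in> ball p r \<Longrightarrow> deriv \<psi> z * deriv \<phi> (\<psi> z) = 1"
    "\<And>z. z \<in> ball p r \<Longrightarrow> \<phi> (\<psi> z) = z"
    by (rule holomorphic_has_inverse[OF hol' open_ball r(3)]) auto
  have op: "open (\<psi> ` ball p r)" by (rule open_mapping_thm3[OF hol' _ r(3)]) simp
  have "0 \<in> \<psi> ` ball p r" using r(1) assms(3) by (metis centre_in_ball imageI)
  with op obtain \<rho> where \<rho>: "\<rho> > 0" "ball 0 \<rho> \<subseteq> \<psi> ` ball p r"
    by (rule openE)
  define U where "U = ball p r \<inter> \<psi> -` ball 0 \<rho>"
  have U: "U \<subseteq> ball p r" by (auto simp: U_def)
  have inv: "\<phi> w \<in> U \<and> \<psi> (\<phi> w) = w" if w: "w \<in> ball 0 \<rho>" for w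
  proof -
    from w \<rho>(2) obtain z where "z \<in> ball p r" "w = \<psi> z" by auto
    thus ?thesis using w \<phi>(3) by (simp add: U_def)
  qed
  have "straightening_chart U p \<rho> \<psi> \<phi>"
  proof
    show "open U" unfolding U_def
      using continuous_open_preimage[OF holomorphic_on_imp_continuous_on[OF hol'] open_ball open_ball] .
    show "\<psi> holomorphic_on U" by (rule holomorphic_on_subset[OF hol' U])
    show "\<phi> holomorphic_on ball 0 \<rho>" by (rule holomorphic_on_subset[OF \<phi>(1) \<rho>(2)])
    show "\<phi> 0 = p" using \<phi>(3)[of p] r(1) assms(3) by simp
    show "\<phi> (\<psi> z) = z" if "z \<in> U" for z using \<phi>(3) U that by blast
  qed (use \<rho> inv in \<open>auto simp: U_def\<close>)
  thus ?thesis using that[of U \<rho> \<phi>] U r(2) by blast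
qed

section \<open>The derivative near a pole\<close>

text \<open>With \<open>c = k z0\<close> and \<open>n = s + 1\<close>, the chart is
  \<open>z - z0\<close> times an \<open>n\<close>-th root of \<open>c / k z\<close> and a rotation.
  Its \<open>n\<close>-th power cancels the pole and the variation of \<open>k\<close>, and the
  rotation removes the argument of \<open>c\<close>, which leaves the positive constant
  \<open>norm c\<close>.\<close>

lemma pole_derivative_normal_form:
  assumes "r > 0" and hol: "h holomorphic_on ball z0 r" and "h z0 \<noteq> 0" and "s \<ge> 1"
    and f: "\<And>z. z \<in> ball z0 r - {z0} \<Longrightarrow> f z = h z / (z - z0) ^ s"
    and arg: "is_Arg (- of_nat s * h z0) \<alpha>"
  obtains d \<psi> where "d > 0" "d \<le> r" "\<psi> holomorphic_on ball z0 d" "\<psi> z0 = 0"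
    "deriv \<psi> z0 = cis (- \<alpha> / (real s + 1))"
    "\<And>z. z \<in> ball z0 d - {z0} \<Longrightarrow>
       deriv f z * \<psi> z ^ (s + 1) = of_real (norm (of_nat s * h z0))"
proof -
  \<comment> \<open>This is the numerator from the quotient rule after cancelling
    \<open>(z - z0) ^ (s - 1)\<close>.\<close>
  define k where "k z = deriv h z * (z - z0) - of_nat s * h z" for z
  define c where "c = k z0"
  have c: "c = - of_nat s * h z0" by (simp add: c_def k_def)
  have c0: "c \<noteq> 0" using assms by (simp add: c)
  have holk: "k holomorphic_on ball z0 r"
    unfolding k_def using hol by (auto intro!: holomorphic_intros)
  have deriv_f: "deriv f z = k z / (z - z0) ^ (s + 1)" if z: "z \<in> ball z0 r - {z0}" for z
  proof -
    have hz: "(h has_field_derivative deriv h z) (at z)"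
      using holomorphic_derivI[OF hol open_ball] z by auto
    have "((\<lambda>z. (z - z0) ^ s) has_field_derivative of_nat s * (z - z0) ^ (s - 1)) (at z)"
      by (auto intro!: derivative_eq_intros)
    moreover have "(z - z0) ^ s \<noteq> 0" using z by simp
    ultimately have quot: "((\<lambda>z. h z / (z - z0) ^ s) has_field_derivative
        (deriv h z * (z - z0) ^ s - h z * (of_nat s * (z - z0) ^ (s - 1))) /
        ((z - z0) ^ s * (z - z0) ^ s)) (at z)"
      by (rule DERIV_divide[OF hz])
    obtain q where q: "s = Suc q" using assms(4) by (cases s) auto
    have "((\<lambda>z. h z / (z - z0) ^ s) has_field_derivative k z / (z - z0) ^ (s + 1)) (at z)"
    proof (rule DERIV_cong[OF quot])
      have "(u * A - B) / (u ^ s * u) = (A * u ^ s - B * u ^ (s - 1)) / (u ^ s * u ^ s)"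
        if "u \<noteq> 0" for u A B :: complex
        using that by (simp add: q field_simps)
      from this[of "z - z0" "deriv h z" "of_nat s * h z"] z
      show "(deriv h z * (z - z0) ^ s - h z * (of_nat s * (z - z0) ^ (s - 1))) /
          ((z - z0) ^ s * (z - z0) ^ s) = k z / (z - z0) ^ (s + 1)"
        by (simp add: k_def mult_ac)
    qed
    hence "(f has_field_derivative k z / (z - z0) ^ (s + 1)) (at z)"
    proof (rule has_field_derivative_transform_within_open)
      show "open (ball z0 r - {z0})" by (rule open_delete[OF open_ball])
      show "z \<in> ball z0 r - {z0}" by (rule z)
      show "\<And>z. z \<in> ball z0 r - {z0} \<Longrightarrow> h z / (z - z0) ^ s = f z" by (simp only: f)
    qed
    thus ?thesis by (rule DERIV_imp_deriv)
  qed
  \<comment> \<open>Near \<open>z0\<close> the quotient \<open>k z / c\<close> stays in the unit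
    disc around 1. This disc lies in the right half-plane and so avoids the branch cut of
    \<open>Ln\<close>.\<close>
  have "continuous_on (ball z0 r) (\<lambda>z. k z / c)"
    using c0 by (intro continuous_intros holomorphic_on_imp_continuous_on[OF holk]) blast
  hence "open (ball z0 r \<inter> (\<lambda>z. k z / c) -` ball 1 1)"
    using open_ball open_ball by (rule continuous_open_preimage)
  moreover have "z0 \<in> ball z0 r \<inter> (\<lambda>z. k z / c) -` ball 1 1"
    using assms(1) c0 unfolding c_def by simp
  ultimately obtain d0 where d0: "d0 > 0" "ball z0 d0 \<subseteq> ball z0 r \<inter> (\<lambda>z. k z / c) -` ball 1 1"
    by (rule openE)
  define d where "d = min d0 r"
  have d: "d > 0" "d \<le> r" "ball z0 d \<subseteq> ball z0 r" "\<And>z. z \<in> ball z0 d \<Longrightarrow> k z / c \<in> ball 1 1"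
    using d0 assms(1) by (auto simp: d_def)
  have slit: "k z / c \<notin> \<real>\<^sub>\<le>\<^sub>0" if "z \<in> ball z0 d" for z
  proof
    assume "k z / c \<in> \<real>\<^sub>\<le>\<^sub>0"
    hence "Re (k z / c) \<le> 0" by (auto simp: complex_nonpos_Reals_iff)
    moreover have "\<bar>Re (1 - k z / c)\<bar> < 1"
      using d(4)[OF that] abs_Re_le_cmod[of "1 - k z / c"] by (simp add: dist_norm)
    ultimately show False by simp
  qed
  define n where "n = s + 1"
  have n: "n \<noteq> 0" by (simp add: n_def)
  \<comment> \<open>This is the root of \<open>c / k z\<close> given by the principal logarithm,
    normalized to 1 at \<open>z0\<close>, so that \<open>deriv \<psi> z0\<close> is the rotation
    factor alone.\<close>
  define v where "v z = exp (- Ln (k z / c) / of_nat n)" for z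
  define \<psi> where "\<psi> z = (z - z0) * v z * cis (- \<alpha> / real n)" for z
  have holv: "v holomorphic_on ball z0 d"
    unfolding v_def using holomorphic_on_subset[OF holk d(3)] slit c0
    by (intro holomorphic_intros) (auto simp: n_def)
  show ?thesis
  proof (rule that[of d \<psi>])
    show "\<psi> holomorphic_on ball z0 d"
      unfolding \<psi>_def by (intro holomorphic_intros holv)
    have "v z0 = 1" using c0 by (simp add: v_def c_def)
    have "(v has_field_derivative deriv v z0) (at z0)"
      using holomorphic_derivI[OF holv open_ball] d(1) by auto
    hence "(\<psi> has_field_derivative cis (- \<alpha> / real n)) (at z0)"
      unfolding \<psi>_def using \<open>v z0 = 1\<close> by (auto intro!: derivative_eq_intros)
    thus "deriv \<psi> z0 = cis (- \<alpha> / (real s + 1))"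
      by (simp add: DERIV_imp_deriv n_def add.commute)
    fix z assume z: "z \<in> ball z0 d - {z0}"
    have kz: "k z / c \<noteq> 0" using slit z by fastforce
    have "v z ^ n = exp (of_nat n * (- Ln (k z / c) / of_nat n))"
      unfolding v_def by (rule exp_of_nat_mult[symmetric])
    also have "\<dots> = c / k z"
      using kz n by (simp add: exp_minus)
    finally have "\<psi> z ^ n = (z - z0) ^ n * (c / k z) * cis (real n * (- \<alpha> / real n))"
      by (simp only: \<psi>_def power_mult_distrib Complex.DeMoivre)
    also have "real n * (- \<alpha> / real n) = - \<alpha>" using n by simp
    finally have \<psi>n: "\<psi> z ^ n = (z - z0) ^ n * (c / k z) * cis (- \<alpha>)" .
    have "z \<in> ball z0 r - {z0}" using z d(3) by blast
    from deriv_f[OF this] have "deriv f z = k z / (z - z0) ^ n" by (simp only: n_def)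
    hence "deriv f z * \<psi> z ^ n = c * cis (- \<alpha>)"
      unfolding \<psi>n using z kz by simp
    moreover have "c = of_real (norm c) * cis \<alpha>"
      using arg unfolding c is_Arg_def cis_conv_exp .
    hence "c * cis (- \<alpha>) = of_real (norm c) * (cis \<alpha> * cis (- \<alpha>))"
      by (simp only: mult.assoc[symmetric])
    hence "c * cis (- \<alpha>) = of_real (norm c)"
      by (simp add: cis_mult)
    ultimately show "deriv f z * \<psi> z ^ (s + 1) = of_real (norm (of_nat s * h z0))"
      by (simp only: n_def c norm_mult norm_minus_cancel mult_minus_left)
  qed (use d in \<open>auto simp: \<psi>_def\<close>)
qed

text \<open>Multiplying the expansion by \<open>(z - z0) ^ s\<close> gives
  \<open>h z - a = O(z - z0)\<close>, so \<open>h\<close> tends to \<open>a\<close>, and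
  \<open>h\<close> is continuous at \<open>z0\<close>. This links the given \<open>a\<close> with
  the holomorphic factor at the pole.\<close>

lemma pole_leading_coefficient_unique:
  assumes "r > 0" and hol: "h holomorphic_on ball z0 r"
    and f: "\<And>z. z \<in> ball z0 r - {z0} \<Longrightarrow> f z = h z / (z - z0) ^ s"
    and O: "(\<lambda>z. f z - a / (z - z0) ^ s) \<in> O[at z0](\<lambda>z. (z - z0) powi (1 - int s))"
  shows "h z0 = a"
proof -
  have ev: "\<forall>\<^sub>F z in at z0. z \<in> ball z0 r - {z0}"
    using assms(1) eventually_at_ball'[of r z0 UNIV] by (auto elim: eventually_mono)
  have "(\<lambda>z. (f z - a / (z - z0) ^ s) * (z - z0) ^ s) \<in> O[at z0](\<lambda>z. (z - z0) powi (1 - int s) * (z - z0) ^ s)"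
    by (rule landau_o.big.mult[OF O]) simp
  also have "?this \<longleftrightarrow> (\<lambda>z. h z - a) \<in> O[at z0](\<lambda>z. z - z0)"
  proof (rule landau_o.big.cong_ex)
    show "\<forall>\<^sub>F z in at z0. (f z - a / (z - z0) ^ s) * (z - z0) ^ s = h z - a"
      using ev by eventually_elim (use f in \<open>auto simp: field_simps\<close>)
    show "\<forall>\<^sub>F z in at z0. (z - z0) powi (1 - int s) * (z - z0) ^ s = z - z0"
      using ev by eventually_elim (auto simp: power_int_diff)
  qed
  finally have "(\<lambda>z. h z - a) \<in> O[at z0](\<lambda>z. z - z0)" .
  moreover have "((\<lambda>z. z - z0) \<longlongrightarrow> 0) (at z0)"
    by (rule LIM_zero) simp
  hence "(\<lambda>z. z - z0) \<in> o[at z0](\<lambda>_. 1)"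
    by (intro smalloI_tendsto) auto
  ultimately have "(\<lambda>z. h z - a) \<in> o[at z0](\<lambda>_. 1)"
    by (rule landau_o.big_small_trans)
  hence "((\<lambda>z. h z - a) \<longlongrightarrow> 0) (at z0)"
    by (auto dest: smalloD_tendsto)
  hence "(h \<longlongrightarrow> a) (at z0)" by (rule LIM_zero_cancel)
  moreover have "isCont h z0"
    using holomorphic_on_imp_continuous_on[OF hol] assms(1) by (simp add: continuous_on_eq_continuous_at)
  hence "(h \<longlongrightarrow> h z0) (at z0)" by (simp add: isCont_def)
  ultimately show ?thesis using LIM_unique by blast
qed

text \<open>The other zeros of \<open>P\<close> are finitely many, so their complement is open. The
  factorization at a pole requires such a punctured neighbourhood.\<close>

lemma rat_fun_holomorphic_punctured:
  assumes "P \<noteq> 0"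
  obtains S where "open S" "z0 \<in> S" "rat_fun Q P holomorphic_on S - {z0}"
proof
  let ?S = "- ({z. poly P z = 0} - {z0})"
  show "open ?S" using poly_roots_finite[OF assms] by (intro open_Compl finite_imp_closed) auto
  show "rat_fun Q P holomorphic_on ?S - {z0}"
    unfolding rat_fun_def by (intro holomorphic_intros) auto
qed auto

section \<open>Branches of the inflection curve\<close>

text \<open>Over the reals, \<open>u\<close> and \<open>\<i> * u\<close> form an orthonormal basis
  of the plane: the coordinates of \<open>x\<close> are the real and imaginary parts of
  \<open>x * cnj u\<close>. The differing tangents also show that \<open>A\<close> and
  \<open>B\<close> are distinct.\<close>

lemma orthogonal_branches_imp_node:
  assumes "card \<B> = 2" and lb: "local_branches C p \<B>" and A: "A \<in> \<B>" and B: "B \<in> \<B>"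
    and tA: "tangent_directions A p = {u, - u}"
    and tB: "tangent_directions B p = {\<i> * u, - (\<i> * u)}" and u: "norm u = 1"
  shows "ordinary_real_node C p"
proof -
  have uu: "cnj u * u = 1"
    using u by (simp add: complex_norm_square[symmetric] mult.commute)
  have "u \<noteq> 0" using u by auto
  hence "u \<noteq> \<i> * u" and "u \<noteq> - (\<i> * u)"
    by (auto simp: complex_eq_iff)
  hence "u \<notin> tangent_directions B p" unfolding tB by blast
  hence "A \<noteq> B" using tA by blast
  moreover have "\<B> = {A, B}"
  proof -
    from assms(1) obtain X Y where "\<B> = {X, Y}" by (auto simp: card_2_iff)
    thus ?thesis using A B \<open>A \<noteq> B\<close> by auto
  qed
  moreover have "x \<in> span ({u, - u} \<union> {\<i> * u, - (\<i> * u)})" for x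
  proof -
    define c where "c = x * cnj u"
    have "x = c * u" using uu by (simp add: c_def mult.assoc)
    also have "\<dots> = Re c *\<^sub>R u + Im c *\<^sub>R (\<i> * u)"
      by (simp add: complex_eq_iff algebra_simps)
    finally have "x = Re c *\<^sub>R u + Im c *\<^sub>R (\<i> * u)" .
    moreover have "Re c *\<^sub>R u + Im c *\<^sub>R (\<i> * u) \<in> span ({u, - u} \<union> {\<i> * u, - (\<i> * u)})"
      by (intro span_add span_scale span_base) auto
    ultimately show ?thesis by (simp only:)
  qed
  hence "span (tangent_directions A p \<union> tangent_directions B p) = UNIV"
    unfolding tA tB by blast
  ultimately show ?thesis
    unfolding ordinary_real_node_def using lb by auto
qed

text \<open>A shift of the index by \<open>s + 1\<close> adds pi to the angle. This matches the two
  opposite tangents of a branch with two entries of the list of rays.\<close>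

lemma cis_ray_angle_opposite: "cis (ray_angle \<alpha> s (m + s + 1)) = - cis (ray_angle \<alpha> s m)"
proof -
  have "ray_angle \<alpha> s (m + s + 1) = ray_angle \<alpha> s m + pi"
    by (simp add: ray_angle_def field_simps)
  thus ?thesis by (simp add: minus_cis)
qed

theorem theorem4p1:
  fixes P Q :: "complex poly" and z0 a :: complex and s :: nat and \<alpha> :: real
  assumes "P \<noteq> 0" and "coprime P Q"
    and "\<not> rat_fun Q P constant_on {z. poly P z \<noteq> 0}"
    and "s \<ge> 1" and "is_pole (rat_fun Q P) z0" and "zorder (rat_fun Q P) z0 = - int s"
    and "a \<noteq> 0"
    and "(\<lambda>z. rat_fun Q P z - a / (z - z0) ^ s) \<in> O[at z0](\<lambda>z. (z - z0) powi (1 - int s))"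
    and "is_Arg (- of_nat s * a) \<alpha>"
  shows "(\<exists>\<B>. card \<B> = s + 1 \<and> local_branches (inflection_curve Q P) z0 \<B> \<and>
            (\<Union>B\<in>\<B>. tangent_directions B z0) = {cis (ray_angle \<alpha> s m) | m. m \<le> 2 * s + 1} \<and>
            (\<forall>m\<le>s. \<exists>B\<in>\<B>. tangent_directions B z0 =
               {cis (ray_angle \<alpha> s m), cis (ray_angle \<alpha> s (m + s + 1))}))
         \<and> (s = 1 \<longrightarrow> ordinary_real_node (inflection_curve Q P) z0)"
proof -
  define R where "R = rat_fun Q P"
  define C where "C = inflection_curve Q P"
  define n where "n = s + 1"
  obtain S where S: "open S" "z0 \<in> S" "R holomorphic_on S - {z0}"
    using rat_fun_holomorphic_punctured[OF assms(1)] unfolding R_def by blast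
  define h where "h = zor_poly R z0"
  have "\<exists>r>0. cball z0 r \<subseteq> S \<and> h holomorphic_on cball z0 r \<and>
      (\<forall>w\<in>cball z0 r - {z0}. R w = h w / (w - z0) ^ nat (- zorder R z0) \<and> h w \<noteq> 0)"
    unfolding h_def using zorder_exist_pole[OF S(3,1,2)] assms(5) unfolding R_def by blast
  then obtain r where r: "r > 0" "h holomorphic_on cball z0 r"
    and R: "\<And>w. w \<in> cball z0 r - {z0} \<Longrightarrow> R w = h w / (w - z0) ^ s \<and> h w \<noteq> 0"
    using assms(6) unfolding R_def by auto
  have hol: "h holomorphic_on ball z0 r"
    by (rule holomorphic_on_subset[OF r(2) ball_subset_cball])
  have R_eq: "R w = h w / (w - z0) ^ s" and R_nz: "R w \<noteq> 0" if "w \<in> ball z0 r - {z0}" for w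
    using R[of w] that by auto
  \<comment> \<open>The chart is built from \<open>h z0\<close>, whereas the angles are stated
    through \<open>a\<close>.\<close>
  have ha: "h z0 = a"
    using assms(8) by (intro pole_leading_coefficient_unique[OF r(1) hol R_eq]) (simp_all add: R_def)
  have h0: "h z0 \<noteq> 0" and arg: "is_Arg (- of_nat s * h z0) \<alpha>"
    using assms(7,9) ha by simp_all
  obtain d \<psi> where d: "d > 0" "d \<le> r" and hol\<psi>: "\<psi> holomorphic_on ball z0 d" and "\<psi> z0 = 0"
    and d\<psi>: "deriv \<psi> z0 = cis (- \<alpha> / (real s + 1))"
    and normal: "\<And>z. z \<in> ball z0 d - {z0} \<Longrightarrow>
      deriv R z * \<psi> z ^ (s + 1) = of_real (norm (of_nat s * h z0))"
    using pole_derivative_normal_form[OF r(1) hol h0 assms(4) R_eq arg] by blast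
  obtain U \<rho> \<phi> where U: "U \<subseteq> ball z0 d" and chart: "straightening_chart U z0 \<rho> \<psi> \<phi>"
    using straightening_chart_exists[OF d(1) hol\<psi> \<open>\<psi> z0 = 0\<close>] d\<psi> by (metis cis_neq_zero)
  interpret straightening_chart U z0 \<rho> \<psi> \<phi> by (rule chart)
  \<comment> \<open>Here \<open>deriv R z\<close> is a nonzero real number divided by
    \<open>\<psi> z ^ n\<close>, and a nonzero number is real iff its inverse is.\<close>
  have "Im (deriv R z) = 0 \<longleftrightarrow> Im (\<psi> z ^ n) = 0" if z: "z \<in> U - {z0}" for z
  proof -
    define N where "N = norm (of_nat s * h z0)"
    have N: "N \<noteq> 0" using assms(4) h0 by (simp add: N_def)
    define w where "w = \<psi> z ^ n"
    have prod: "deriv R z * w = of_real N"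
      using normal[of z] z U by (auto simp: n_def N_def w_def)
    hence w: "w \<noteq> 0" using N by auto
    hence "deriv R z = of_real N * inverse w"
      using prod by (simp add: field_simps)
    thus ?thesis using N w unfolding w_def[symmetric] by (auto simp: complex_neq_0)
  qed
  moreover have "R z \<noteq> 0 \<and> poly P z \<noteq> 0" if "z \<in> U - {z0}" for z
  proof -
    have "R z \<noteq> 0" using R_nz[of z] that U d(2) by auto
    \<comment> \<open>a zero of \<open>P\<close> would give \<open>R z = 0\<close>, as division by zero yields zero\<close>
    thus ?thesis by (auto simp: R_def rat_fun_def)
  qed
  \<comment> \<open>This excludes \<open>z0\<close> from the set whose closure is the curve;
    otherwise \<open>R\<close> would be continuous at its pole.\<close>
  moreover have "poly P z0 = 0"
  proof (rule ccontr)
    assume "poly P z0 \<noteq> 0"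
    hence "isCont R z0" unfolding R_def rat_fun_def by (intro continuous_intros) auto
    thus False using assms(5) not_tendsto_and_filterlim_at_infinity[of "at z0" R "R z0"]
      unfolding R_def is_pole_def isCont_def by auto
  qed
  ultimately have "{z. R z \<noteq> 0 \<and> poly P z \<noteq> 0 \<and> Im (deriv R z) = 0} \<inter> U
      = {z \<in> U - {z0}. Im (\<psi> z ^ n) = 0}"
    by blast
  from closure_punctured_lines[OF _ this]
  have CU: "C \<inter> U = (\<Union>m<n. line_preimage (cis (real m * pi / real n)))"
    unfolding C_def inflection_curve_def R_def n_def by simp
  define L where "L m = line_preimage (cis (real m * pi / real n))" for m
  define \<B> where "\<B> = L ` {..<n}"
  have card: "card \<B> = n" and lb: "local_branches C z0 \<B>"
    using local_branches_lines[OF CU] unfolding \<B>_def L_def[abs_def] by auto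
  \<comment> \<open>The inverse chart rotates the standard lines at angles \<open>m * pi / n\<close>
    by \<open>\<alpha> / (s + 1)\<close>, which produces the angles
    \<open>ray_angle \<alpha> s m\<close>.\<close>
  have "deriv \<phi> 0 * cis (- \<alpha> / (real s + 1)) = 1"
    using deriv_inverse[of 0] radius_pos inverse_0 d\<psi> by simp
  hence "deriv \<phi> 0 * (cis (- \<alpha> / (real s + 1)) * cis (\<alpha> / (real s + 1))) = cis (\<alpha> / (real s + 1))"
    by (simp only: mult.assoc[symmetric] mult_1_left)
  hence d\<phi>: "deriv \<phi> 0 = cis (\<alpha> / (real s + 1))"
    by (simp add: cis_mult)
  have tangent: "tangent_directions (L m) z0 = {cis (ray_angle \<alpha> s m), - cis (ray_angle \<alpha> s m)}" for m
  proof -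
    have "cis (real m * pi / real n) * deriv \<phi> 0 = cis (ray_angle \<alpha> s m)"
      unfolding d\<phi> cis_mult ray_angle_def n_def by (simp add: add_divide_distrib add.commute)
    thus ?thesis
      unfolding L_def by (simp add: tangent_directions_line_preimage sgn_eq)
  qed
  have tangents: "\<forall>m\<le>s. \<exists>B\<in>\<B>. tangent_directions B z0 =
      {cis (ray_angle \<alpha> s m), cis (ray_angle \<alpha> s (m + s + 1))}"
    unfolding cis_ray_angle_opposite \<B>_def n_def using tangent by auto
  have union: "(\<Union>B\<in>\<B>. tangent_directions B z0) = {cis (ray_angle \<alpha> s m) | m. m \<le> 2 * s + 1}"
  proof -
    have "(\<Union>B\<in>\<B>. tangent_directions B z0) =
        (\<Union>m<n. {cis (ray_angle \<alpha> s m), cis (ray_angle \<alpha> s (m + s + 1))})"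
      unfolding \<B>_def cis_ray_angle_opposite by (simp add: tangent)
    also have "\<dots> = {cis (ray_angle \<alpha> s m) | m. m \<le> 2 * s + 1}"
    proof (intro equalityI subsetI)
      fix u assume "u \<in> {cis (ray_angle \<alpha> s m) | m. m \<le> 2 * s + 1}"
      then obtain m where m: "m \<le> 2 * s + 1" "u = cis (ray_angle \<alpha> s m)" by blast
      show "u \<in> (\<Union>m<n. {cis (ray_angle \<alpha> s m), cis (ray_angle \<alpha> s (m + s + 1))})"
      proof (cases "m < n")
        \<comment> \<open>The second half of the list consists of the rays opposite to those with
          index \<open>m - n\<close>.\<close>
        case False
        hence "m = (m - n) + s + 1" "m - n < n" using m(1) by (auto simp: n_def)
        thus ?thesis using m(2) by (metis UN_I insertCI lessThan_iff)
      qed (use m in blast)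
    next
      fix u assume "u \<in> (\<Union>m<n. {cis (ray_angle \<alpha> s m), cis (ray_angle \<alpha> s (m + s + 1))})"
      then obtain m where "m < n" "u = cis (ray_angle \<alpha> s m) \<or> u = cis (ray_angle \<alpha> s (m + s + 1))"
        by blast
      moreover from this have "m \<le> 2 * s + 1" "m + s + 1 \<le> 2 * s + 1" by (simp_all add: n_def)
      ultimately show "u \<in> {cis (ray_angle \<alpha> s m) | m. m \<le> 2 * s + 1}" by blast
    qed
    finally show ?thesis .
  qed
  have "ordinary_real_node C z0" if s: "s = 1"
  proof (rule orthogonal_branches_imp_node)
    show "card \<B> = 2" using card s by (simp add: n_def)
    show "local_branches C z0 \<B>" by (rule lb)
    show "L 0 \<in> \<B>" "L 1 \<in> \<B>" using s by (auto simp: \<B>_def n_def)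
    show "tangent_directions (L 0) z0 = {cis (ray_angle \<alpha> s 0), - cis (ray_angle \<alpha> s 0)}"
      by (rule tangent)
    \<comment> \<open>For a simple pole consecutive rays are a right angle apart, so the two
      branches cross orthogonally.\<close>
    have "ray_angle \<alpha> s 1 = pi / 2 + ray_angle \<alpha> s 0"
      using s by (simp add: ray_angle_def field_simps)
    hence "cis (ray_angle \<alpha> s 1) = \<i> * cis (ray_angle \<alpha> s 0)"
      by (simp only: cis_mult[symmetric] cis_pi_half)
    with tangent[of 1] show "tangent_directions (L 1) z0 =
        {\<i> * cis (ray_angle \<alpha> s 0), - (\<i> * cis (ray_angle \<alpha> s 0))}" by simp
  qed simp
  thus ?thesis using card lb union tangents unfolding C_def n_def by blast
qed

end
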